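(* Let $U=N\times(\mathbb R^{k-m}\times T^m)\to N$ be a toroidal domain of a $k$-dimensional commutative dynamical algebra $\mathcal A$, with bundle coordinates $(r^A,y^\lambda)$. Let $$w=w_1+w_2=w^{A\lambda}(r^B)\,\partial_A\wedge\partial_\lambda+w^{\mu\nu}(r^B,y^\lambda)\,\partial_\mu\wedge\partial_\nu,\qquad w'=w_1'+w_2'=w'^{A\lambda}(r^B)\,\partial_A\wedge\partial_\lambda+w'^{\mu\nu}(r^B,y^\lambda)\,\partial_\mu\wedge\partial_\nu$$ be two different Poisson bivector fields of rank $2k$ on $U$ which make $\mathcal A$ into two partially integrable systems $(w,\mathcal A)$ and $(w',\mathcal A)$. (I) The triple $(w,w',\mathcal A)$ is a bi-Hamiltonian partially integrable system if and only if $w$ and $w'$ differ only in the second terms $w_2$ and $w_2'$ (i.e. $w_1=w_1'$). (II) Such Poisson bivector fields (differing only in the second terms) admit a recursion operator.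
   Context: Setting. $\mathcal A$ is a commutative dynamical algebra on a smooth manifold $Z$: given $k$ mutually commuting vector fields $\vartheta_\lambda$ on $Z$, independent almost everywhere (the set where $\vartheta_1\wedge\dots\wedge\vartheta_k$ vanishes is nowhere dense), $\mathcal S$ is the ring of smooth functions annihilated by all $\vartheta_\lambda$ (integrals of motion) and $\mathcal A$ is the $k$-dimensional $\mathcal S$-Lie algebra generated by the $\vartheta_\lambda$. On an open subset, $\mathcal A$ and $\mathcal S$ are understood as restricted to it. Toroidal domain $U$: an open subset of $Z$, a neighbourhood of a regular invariant manifold of $\mathcal A$ (an orbit of the flows of the $\vartheta_\lambda$ on which $\vartheta_1\wedge\dots\wedge\vartheta_k\ne0$), presented as a trivial principal bundle $\pi:U=N\times(\mathbb R^{k-m}\times T^m)\to N$ over a domain $N\subset\mathbb R^{\dim Z-k}$ whose fibers are invariant manifolds. It carries coordinates $(r^A)$ on $N$ and standard coordinates $(y^\lambda)=(t^a,\varphi^i)$, $a=1,\dots,k-m$, $i=1,\dots,m$, on $\mathbb R^{k-m}\times T^m$, in which $$\vartheta_a=\partial_a,\qquad \vartheta_i=-(BC^{-1})_i^a(r)\partial_a+(C^{-1})_i^k(r)\partial_k$$ with $B,C$ smooth matrix functions on $N$ and $C$ nondegenerate; so on $U$ one has $\mathcal S=\pi^*C^\infty(N)$ and $\mathcal A$ is generated over $\mathcal S$ by $\partial_\lambda=\partial/\partial y^\lambda$. Here $\partial_A=\partial/\partial r^A$; summation over repeated indices. Partially integrable system (PIS): a $k$-dimensional commutative dynamical algebra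 $\mathcal A$ on a regular Poisson manifold is a PIS $(w,\mathcal A)$ if (a) $\mathcal A$ is generated (over $\mathcal S$) by the Hamiltonian vector fields of $k$ almost everywhere independent integrals of motion $H_\lambda$ in involution (the set where $dH_1\wedge\dots\wedge dH_k$ vanishes is nowhere dense), and (b) all elements of $\mathcal S$ are mutually in involution. The Hamiltonian vector field of $f$ is $-w\lfloor df$, i.e. the derivation $g\mapsto\{f,g\}$ of the Poisson bracket defined by $w$. Bi-Hamiltonian PIS: given two PISs $(w,\mathcal A)$ and $(w',\mathcal A)$, the triple $(w,w',\mathcal A)$ is a bi-Hamiltonian PIS if any Hamiltonian vector field $\vartheta\in\mathcal A$ with respect to $w$ possesses the same Hamilton representation $\vartheta=-w\lfloor df=-w'\lfloor df$, $f\in\mathcal S$, relative to $w'$, and vice versa. Recursion operator: for Poisson bivector fields $w,w'$ on a manifold $X$ with corresponding bundle homomorphisms $w^\sharp,w'^\sharp:T^*X\to TX$, $\alpha\mapsto-w\lfloor\alpha$, resp. $\alpha\mapsto-w'\lfloor\alpha$, a recursion operator is a tangent-valued one-form $R$ on $X$ whose associated bundle endomorphisms $R:TX\to TX$ and (dual) $R^*:T^*X\to T^*X$ satisfy $w'^\sharp=R\circ w^\sharp=w^\sharp\circ R^*$. *)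

theory Defs
  imports "HOL-Analysis.Analysis"
begin

section \<open>Smooth maps on open sets\<close>

primrec Ck_on :: "nat \<Rightarrow> 'a set \<Rightarrow> ('a::real_normed_vector \<Rightarrow> 'b::real_normed_vector) \<Rightarrow> bool" where
  "Ck_on 0 S f \<longleftrightarrow> continuous_on S f"
| "Ck_on (Suc n) S f \<longleftrightarrow> (\<forall>x\<in>S. f differentiable (at x)) \<and>
     (\<forall>v. Ck_on n S (\<lambda>x. frechet_derivative f (at x) v))"

definition smooth_on :: "'a set \<Rightarrow> ('a::real_normed_vector \<Rightarrow> 'b::real_normed_vector) \<Rightarrow> bool" where
  "smooth_on S f \<longleftrightarrow> (\<forall>n. Ck_on n S f)"


section \<open>The total space of a trivial bundle with fibre a product of lines and circles\<close>

text \<open>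
  Coordinates are indexed by a sum type: \<open>Inl A\<close> is the base coordinate \<open>r\<^sup>A\<close>, \<open>Inr l\<close> is the
  fibre coordinate \<open>y\<^sup>l\<close>. The set \<open>M\<close> of fibre indices (any subset, \<open>card M = m\<close>) singles out
  the angle coordinates, so that the total space \<open>U\<close> is the quotient of \<open>N \<times> \<real>\<^sup>k\<close> by the
  translations of the coordinates \<open>y\<^sup>i\<close>, \<open>i \<in> M\<close>, by multiples of \<open>2\<pi>\<close>. Functions and tensor fields
  on \<open>U\<close> are represented by their lifts to this covering, i.e. (using the global coordinate frame) by
  periodic maps on \<open>total_space N\<close>. Their values outside \<open>total_space N\<close> are irrelevant.
\<close>

definition base :: "real^('n + 'k::finite) \<Rightarrow> real^'n" where
  "base z = (\<chi> A. z $ Inl A)"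

definition total_space :: "(real^'n) set \<Rightarrow> (real^('n + 'k::finite)) set" where
  "total_space N = {z. base z \<in> N}"

definition smooth_field ::
  "(real^'n) set \<Rightarrow> 'k::finite set \<Rightarrow> (real^('n + 'k) \<Rightarrow> 'b::real_normed_vector) \<Rightarrow> bool" where
  "smooth_field N M f \<longleftrightarrow> smooth_on (total_space N) f \<and>
     (\<forall>z\<in>total_space N. \<forall>i\<in>M. f (z + (2 * pi) *\<^sub>R axis (Inr i) 1) = f z)"

definition d_base :: "'n::finite \<Rightarrow> real^('n + 'k::finite)" where
  "d_base A = axis (Inl A) 1"

definition d_fibre :: "'k::finite \<Rightarrow> real^('n::finite + 'k)" where
  "d_fibre l = axis (Inr l) 1"

definition differential :: "(real^'a \<Rightarrow> real) \<Rightarrow> real^'a \<Rightarrow> real^'a" where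
  "differential f z = (\<chi> i. frechet_derivative f (at z) (axis i 1))"


section \<open>Dynamical algebras\<close>

text \<open>
  A toroidal domain is given by \<open>N\<close>, \<open>M\<close> and the matrix functions \<open>B\<close>, \<open>C\<close>.
  Upper indices are row indices: \<open>B r $ a $ j\<close> is \<open>B\<^sub>j\<^sup>a(r)\<close> and \<open>C r $ l $ j\<close> is \<open>C\<^sub>j\<^sup>l(r)\<close>. The
  \<open>M \<times> M\<close> matrix \<open>C\<close> is padded by the identity to a \<open>'k \<times> 'k\<close> matrix. Then \<open>matrix_inv (C r)\<close> is the
  inverse of the \<open>M \<times> M\<close> block padded in the same way, and only the entries \<open>B r $ a $ j\<close> with
  \<open>a \<notin> M\<close>, \<open>j \<in> M\<close> enter \<open>toroidal_frame\<close>.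
\<close>

definition toroidal_domain ::
  "(real^'n) set \<Rightarrow> 'k::finite set \<Rightarrow> (real^'n \<Rightarrow> real^'k^'k) \<Rightarrow> (real^'n \<Rightarrow> real^'k^'k) \<Rightarrow> bool" where
  "toroidal_domain N M B C \<longleftrightarrow>
     open N \<and> connected N \<and> N \<noteq> {} \<and> smooth_on N B \<and> smooth_on N C \<and>
     (\<forall>r\<in>N. invertible (C r) \<and>
        (\<forall>l j. l \<notin> M \<or> j \<notin> M \<longrightarrow> C r $ l $ j = (if l = j then 1 else 0)))"

definition toroidal_frame ::
  "'k::finite set \<Rightarrow> (real^'n \<Rightarrow> real^'k^'k) \<Rightarrow> (real^'n \<Rightarrow> real^'k^'k) \<Rightarrow>
   'k \<Rightarrow> real^('n + 'k) \<Rightarrow> real^('n + 'k)" where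
  "toroidal_frame M B C l z =
     (if l \<in> M
      then (\<Sum>j\<in>M. matrix_inv (C (base z)) $ j $ l *\<^sub>R d_fibre j)
         - (\<Sum>a\<in>-M. (B (base z) ** matrix_inv (C (base z))) $ a $ l *\<^sub>R d_fibre a)
      else d_fibre l)"

definition integrals_of_motion ::
  "(real^'n) set \<Rightarrow> 'k::finite set \<Rightarrow> ('k \<Rightarrow> real^('n + 'k) \<Rightarrow> real^('n + 'k)) \<Rightarrow>
   (real^('n + 'k) \<Rightarrow> real) set" where
  "integrals_of_motion N M X =
     {f. smooth_field N M f \<and> (\<forall>l. \<forall>z\<in>total_space N. X l z \<bullet> differential f z = 0)}"

definition generated_by ::
  "(real^'n) set \<Rightarrow> (real^('n + 'k::finite) \<Rightarrow> real) set \<Rightarrow> ('k \<Rightarrow> real^('n + 'k) \<Rightarrow> real^('n + 'k)) \<Rightarrow>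
   (real^('n + 'k) \<Rightarrow> real^('n + 'k)) set" where
  "generated_by N S X =
     {V. \<exists>s. (\<forall>l. s l \<in> S) \<and> (\<forall>z\<in>total_space N. V z = (\<Sum>l\<in>UNIV. s l z *\<^sub>R X l z))}"


section \<open>Poisson bivector fields\<close>

text \<open>
  A bivector \<open>\<Sum>\<^bsub>i<j\<^esub> w\<^sup>i\<^sup>j \<partial>\<^sub>i \<and> \<partial>\<^sub>j\<close> is represented by the skew-symmetric matrix \<open>w\<^sup>i\<^sup>j\<close>.
\<close>

definition wedge :: "real^'a \<Rightarrow> real^'a \<Rightarrow> real^'a^'a" where
  "wedge u v = (\<chi> i j. u $ i * v $ j - u $ j * v $ i)"

text \<open>\<open>sharp w \<alpha>\<close> is the vector \<open>- w \<lfloor> \<alpha>\<close>, with components \<open>\<Sum>\<^sub>i \<alpha>\<^sub>i w\<^sup>i\<^sup>j\<close>.\<close>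

definition sharp :: "real^'a^'a \<Rightarrow> real^'a \<Rightarrow> real^'a" where
  "sharp w \<alpha> = \<alpha> v* w"

definition ham :: "(real^'a \<Rightarrow> real^'a^'a) \<Rightarrow> (real^'a \<Rightarrow> real) \<Rightarrow> real^'a \<Rightarrow> real^'a" where
  "ham w f z = sharp (w z) (differential f z)"

definition bracket ::
  "(real^'a \<Rightarrow> real^'a^'a) \<Rightarrow> (real^'a \<Rightarrow> real) \<Rightarrow> (real^'a \<Rightarrow> real) \<Rightarrow> real^'a \<Rightarrow> real" where
  "bracket w f g z = ham w f z \<bullet> differential g z"

definition poisson_bivector ::
  "(real^'n) set \<Rightarrow> 'k::finite set \<Rightarrow> (real^('n + 'k) \<Rightarrow> real^('n + 'k)^('n + 'k)) \<Rightarrow> bool" where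
  "poisson_bivector N M w \<longleftrightarrow>
     smooth_field N M w \<and>
     (\<forall>z\<in>total_space N. transpose (w z) = - w z) \<and>
     (\<forall>f g h. smooth_field N M f \<and> smooth_field N M g \<and> smooth_field N M h \<longrightarrow>
        (\<forall>z\<in>total_space N. bracket w f (bracket w g h) z + bracket w g (bracket w h f) z
                    + bracket w h (bracket w f g) z = 0))"

definition regular_of_rank ::
  "nat \<Rightarrow> (real^'n) set \<Rightarrow> (real^('n + 'k::finite) \<Rightarrow> real^('n + 'k)^('n + 'k)) \<Rightarrow> bool" where
  "regular_of_rank p N w \<longleftrightarrow> (\<forall>z\<in>total_space N. rank (w z) = p)"


section \<open>Partially integrable systems\<close>

text \<open>
  The value of \<open>dH\<^sub>1 \<and> \<dots> \<and> dH\<^sub>k\<close> on vectors \<open>v\<^sub>1, \<dots>, v\<^sub>k\<close> is the determinant of \<open>(dH\<^sub>l(v\<^sub>j))\<close>.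
\<close>

definition dependency_locus ::
  "(real^'n) set \<Rightarrow> ('k::finite \<Rightarrow> real^('n + 'k) \<Rightarrow> real) \<Rightarrow> (real^('n + 'k)) set" where
  "dependency_locus N H =
     {z \<in> total_space N. \<forall>v :: 'k \<Rightarrow> real^('n + 'k).
        det ((\<chi> l j. differential (H l) z \<bullet> v j) :: real^'k^'k) = 0}"

definition PIS ::
  "(real^'n) set \<Rightarrow> 'k::finite set \<Rightarrow> (real^('n + 'k) \<Rightarrow> real) set \<Rightarrow>
   (real^('n + 'k) \<Rightarrow> real^('n + 'k)) set \<Rightarrow>
   (real^('n + 'k) \<Rightarrow> real^('n + 'k)^('n + 'k)) \<Rightarrow> bool" where
  "PIS N M S A w \<longleftrightarrow>
     poisson_bivector N M w \<and> (\<exists>p. regular_of_rank p N w) \<and>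
     (\<exists>H :: 'k \<Rightarrow> real^('n + 'k) \<Rightarrow> real.
        (\<forall>l. H l \<in> S) \<and>
        (\<forall>l j. \<forall>z\<in>total_space N. bracket w (H l) (H j) z = 0) \<and>
        interior (closure (dependency_locus N H)) = {} \<and>
        A = generated_by N S (\<lambda>l. ham w (H l))) \<and>
     (\<forall>f\<in>S. \<forall>g\<in>S. \<forall>z\<in>total_space N. bracket w f g z = 0)"

text \<open>
  Every Hamilton representation \<open>V = - w \<lfloor> df\<close> of a vector field \<open>V \<in> A\<close> is required to have \<open>f \<in> S\<close>
  and to be a Hamilton representation \<open>V = - w' \<lfloor> df\<close>, with the same \<open>f\<close>, relative to the other
  bivector field.
\<close>

definition same_hamilton_representations ::
  "(real^'n) set \<Rightarrow> 'k::finite set \<Rightarrow> (real^('n + 'k) \<Rightarrow> real) set \<Rightarrow>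
   (real^('n + 'k) \<Rightarrow> real^('n + 'k)) set \<Rightarrow>
   (real^('n + 'k) \<Rightarrow> real^('n + 'k)^('n + 'k)) \<Rightarrow>
   (real^('n + 'k) \<Rightarrow> real^('n + 'k)^('n + 'k)) \<Rightarrow> bool" where
  "same_hamilton_representations N M S A w w' \<longleftrightarrow>
     (\<forall>V\<in>A. \<forall>f. smooth_field N M f \<and> (\<forall>z\<in>total_space N. V z = ham w f z) \<longrightarrow>
        f \<in> S \<and> (\<forall>z\<in>total_space N. V z = ham w' f z))"

definition bi_hamiltonian_PIS ::
  "(real^'n) set \<Rightarrow> 'k::finite set \<Rightarrow> (real^('n + 'k) \<Rightarrow> real) set \<Rightarrow>
   (real^('n + 'k) \<Rightarrow> real^('n + 'k)) set \<Rightarrow>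
   (real^('n + 'k) \<Rightarrow> real^('n + 'k)^('n + 'k)) \<Rightarrow>
   (real^('n + 'k) \<Rightarrow> real^('n + 'k)^('n + 'k)) \<Rightarrow> bool" where
  "bi_hamiltonian_PIS N M S A w w' \<longleftrightarrow>
     PIS N M S A w \<and> PIS N M S A w' \<and>
     same_hamilton_representations N M S A w w' \<and>
     same_hamilton_representations N M S A w' w"

definition recursion_operator ::
  "(real^'n) set \<Rightarrow> 'k::finite set \<Rightarrow>
   (real^('n + 'k) \<Rightarrow> real^('n + 'k)^('n + 'k)) \<Rightarrow>
   (real^('n + 'k) \<Rightarrow> real^('n + 'k)^('n + 'k)) \<Rightarrow>
   (real^('n + 'k) \<Rightarrow> real^('n + 'k)^('n + 'k)) \<Rightarrow> bool" where
  "recursion_operator N M w w' R \<longleftrightarrow>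
     smooth_field N M R \<and>
     (\<forall>z\<in>total_space N. \<forall>\<alpha>. sharp (w' z) \<alpha> = R z *v sharp (w z) \<alpha> \<and>
                      sharp (w' z) \<alpha> = sharp (w z) (transpose (R z) *v \<alpha>))"


section \<open>Bivector fields adapted to the bundle\<close>

text \<open>\<open>c r $ A $ l\<close> is \<open>w\<^sup>A\<^sup>l(r)\<close>, and \<open>e z $ l $ j\<close> is \<open>w\<^sup>l\<^sup>j(r, y)\<close>.\<close>

definition mixed_part ::
  "(real^'n \<Rightarrow> real^'k::finite^'n) \<Rightarrow> real^('n + 'k) \<Rightarrow> real^('n + 'k)^('n + 'k)" where
  "mixed_part c z = (\<Sum>A\<in>UNIV. \<Sum>l\<in>UNIV. c (base z) $ A $ l *\<^sub>R wedge (d_base A) (d_fibre l))"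

definition fibre_part ::
  "(real^('n::finite + 'k::finite) \<Rightarrow> real^'k^'k) \<Rightarrow> real^('n + 'k) \<Rightarrow> real^('n + 'k)^('n + 'k)" where
  "fibre_part e z = (\<Sum>l\<in>UNIV. \<Sum>j\<in>UNIV. e z $ l $ j *\<^sub>R wedge (d_fibre l) (d_fibre j))"

end

theory Submission
  imports Defs
begin

text \<open>
  In the frame \<open>\<partial>\<^sub>A, \<partial>\<^sub>l\<close> a bivector \<open>w\<^sub>1 + w\<^sub>2\<close> as in the theorem is the block matrix
  \<open>((0, c), (- c\<^sup>T, E))\<close> with \<open>c = (w\<^sup>A\<^sup>l)\<close>; the theorem says that \<open>c\<close> is all the Hamilton
  representations can see. Everything rests on one piece of linear algebra: the range of such a matrix
  lies in the direct sum of the range of \<open>c\<close> and \<open>\<real>\<^sup>k\<close>, so rank \<open>2k\<close> forces \<open>c\<close> to have full column rank \<open>k\<close>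
  (\<open>mixed_block_injective\<close>).

  If \<open>c = c'\<close> and \<open>V = - w \<lfloor> df\<close> belongs to the dynamical algebra, then \<open>V\<close> is tangent to the fibres,
  which reads \<open>c \<partial>f/\<partial>y = 0\<close>. Hence \<open>\<partial>f/\<partial>y = 0\<close>, so \<open>f\<close> is an integral of motion, and the Hamiltonian
  vector field of such an \<open>f\<close> contains \<open>c\<close> but not \<open>E\<close>; it is therefore the same for \<open>w'\<close>
  (\<open>same_hamilton_representationsI\<close>). Conversely, each base coordinate \<open>r\<^sup>A\<close> generates the field
  \<open>c\<^sup>A\<^sup>l \<partial>\<^sub>l\<close>, which lies in the dynamical algebra because its coefficients depend on \<open>r\<close> only and the
  toroidal frame is obtained from the \<open>\<partial>\<^sub>l\<close> by a smooth invertible matrix function of \<open>r\<close>. Having the same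
  Hamiltonian vector fields for all \<open>r\<^sup>A\<close> means \<open>c = c'\<close>
  (\<open>mixed_blocks_eq_if_same_hamilton_representations\<close>).

  For the recursion operator one looks for \<open>R = 1 + ((0, 0), (F, 0))\<close> with \<open>R w = w'\<close>, which amounts to
  \<open>F c = E' - E\<close>. As \<open>c\<close> is injective it has the left inverse \<open>(c\<^sup>T c)\<^sup>-\<^sup>1 c\<^sup>T\<close>, so that
  \<open>F = (E' - E) (c\<^sup>T c)\<^sup>-\<^sup>1 c\<^sup>T\<close> is a solution, and it is smooth by Cramer's rule. The equation
  \<open>w' = w R\<^sup>T\<close> is the transpose of \<open>R w = w'\<close>, by skew-symmetry.
\<close>

section \<open>Calculus of smooth maps\<close>


lemma Ck_on_cong:
  assumes "open S" "\<And>x. x \<in> S \<Longrightarrow> f x = g x" "Ck_on n S f"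
  shows "Ck_on n S g"
  using assms(2,3)
proof (induction n arbitrary: f g)
  case 0
  then show ?case by (simp cong: continuous_on_cong)
next
  case (Suc n)
  have eq: "frechet_derivative f (at x) = frechet_derivative g (at x)" if "x \<in> S" for x
    using Suc.prems that by (intro frechet_derivative_transform_within_open[OF _ assms(1)]) auto
  have "g differentiable (at x)" if "x \<in> S" for x
    using Suc.prems that unfolding differentiable_def Ck_on.simps
    by (meson assms(1) has_derivative_transform_within_open)
  moreover have "Ck_on n S (\<lambda>x. frechet_derivative g (at x) v)" for v
    by (rule Suc.IH[of "\<lambda>x. frechet_derivative f (at x) v"]) (use Suc.prems eq in auto)
  ultimately show ?case by simp
qed

text \<open>
  The recursion in \<open>Ck_on\<close> speaks about the chosen derivative \<open>frechet_derivative\<close>; this rule lets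
  the inductions below supply the derivative by an explicit formula instead.
\<close>

lemma Ck_on_SucI:
  assumes "open S" "\<And>x. x \<in> S \<Longrightarrow> (f has_derivative D x) (at x)"
    and "\<And>v. Ck_on n S (\<lambda>x. D x v)"
  shows "Ck_on (Suc n) S f"
proof -
  have eq: "D x = frechet_derivative f (at x)" if "x \<in> S" for x
    using assms(2) that by (intro frechet_derivative_at)
  have "Ck_on n S (\<lambda>x. frechet_derivative f (at x) v)" for v
    by (rule Ck_on_cong[OF assms(1) _ assms(3)[of v]]) (simp add: eq)
  then show ?thesis
    using assms(2) by (auto simp: differentiable_def)
qed

lemma Ck_on_Suc_has_derivative:
  "Ck_on (Suc n) S f \<Longrightarrow> x \<in> S \<Longrightarrow> (f has_derivative frechet_derivative f (at x)) (at x)"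
  by (simp add: frechet_derivative_works)

lemma Ck_on_SucD: "Ck_on (Suc n) S f \<Longrightarrow> Ck_on n S f"
proof (induction n arbitrary: f)
  case 0
  then show ?case
    by (auto intro!: continuous_at_imp_continuous_on differentiable_imp_continuous_within)
qed auto

lemma Ck_on_const: "Ck_on n S (\<lambda>x. a)"
  by (induction n arbitrary: a) auto

lemma Ck_on_bounded_linear:
  assumes "open S" "bounded_linear L"
  shows "Ck_on n S L"
proof (cases n)
  case 0
  then show ?thesis using assms by (simp add: linear_continuous_on)
next
  case (Suc m)
  have "(L has_derivative L) (at x)" for x
    using assms(2) by (rule bounded_linear_imp_has_derivative)
  then show ?thesis
    unfolding Suc by (rule Ck_on_SucI[OF assms(1)]) (rule Ck_on_const)
qed

lemma Ck_on_compose_linear: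
  assumes "open S" "bounded_linear L" "Ck_on n S f"
  shows "Ck_on n S (\<lambda>x. L (f x))"
  using assms(3)
proof (induction n arbitrary: f)
  case 0
  then show ?case using assms(2) by (simp add: bounded_linear.continuous_on)
next
  case (Suc n)
  have "((\<lambda>x. L (f x)) has_derivative (\<lambda>v. L (frechet_derivative f (at x) v))) (at x)" if "x \<in> S" for x
    by (rule bounded_linear.has_derivative[OF assms(2) Ck_on_Suc_has_derivative[OF Suc.prems that]])
  then show ?case
    by (rule Ck_on_SucI[OF assms(1)]) (use Suc in simp_all)
qed

lemma Ck_on_pullback_linear:
  assumes "open S" "bounded_linear L" "Ck_on n S f"
  shows "Ck_on n (L -` S) (\<lambda>x. f (L x))"
  using assms(3)
proof (induction n arbitrary: f)
  case 0
  show ?case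
    using 0 linear_continuous_on[OF assms(2), of "L -` S"]
    by (auto intro: continuous_on_compose2[of S f])
next
  case (Suc n)
  have o: "open (L -` S)"
    using assms(1,2) by (intro open_vimage linear_continuous_on)
  have "((\<lambda>x. f (L x)) has_derivative (\<lambda>v. frechet_derivative f (at (L x)) (L v))) (at x)"
    if "x \<in> L -` S" for x
    using has_derivative_compose[OF bounded_linear_imp_has_derivative[OF assms(2)]
        Ck_on_Suc_has_derivative[OF Suc.prems, of "L x"]] that by simp
  moreover have "Ck_on n (L -` S) (\<lambda>x. frechet_derivative f (at (L x)) (L v))" for v
    using Suc.IH[of "\<lambda>y. frechet_derivative f (at y) (L v)"] Suc.prems by simp
  ultimately show ?case
    by (rule Ck_on_SucI[OF o])
qed

lemma Ck_on_add:
  assumes "open S" "Ck_on n S f" "Ck_on n S g"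
  shows "Ck_on n S (\<lambda>x. f x + g x)"
  using assms(2,3)
proof (induction n arbitrary: f g)
  case 0
  then show ?case by (simp add: continuous_on_add)
next
  case (Suc n)
  have "((\<lambda>x. f x + g x) has_derivative
      (\<lambda>v. frechet_derivative f (at x) v + frechet_derivative g (at x) v)) (at x)" if "x \<in> S" for x
    by (rule has_derivative_add[OF Suc.prems[THEN Ck_on_Suc_has_derivative[OF _ that]]])
  then show ?case
    by (rule Ck_on_SucI[OF assms(1)]) (use Suc in simp_all)
qed

lemma Ck_on_mult:
  fixes f g :: "'a::real_normed_vector \<Rightarrow> 'b::real_normed_algebra"
  assumes "open S" "Ck_on n S f" "Ck_on n S g"
  shows "Ck_on n S (\<lambda>x. f x * g x)"
  using assms(2,3)
proof (induction n arbitrary: f g)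
  case 0
  then show ?case by (simp add: continuous_on_mult)
next
  case (Suc n)
  have "((\<lambda>x. f x * g x) has_derivative
      (\<lambda>v. f x * frechet_derivative g (at x) v + frechet_derivative f (at x) v * g x)) (at x)"
    if "x \<in> S" for x
    by (rule has_derivative_mult[OF Suc.prems[THEN Ck_on_Suc_has_derivative[OF _ that]]])
  moreover have "Ck_on n S
      (\<lambda>x. f x * frechet_derivative g (at x) v + frechet_derivative f (at x) v * g x)" for v
    by (intro Ck_on_add assms(1) Suc.IH Suc.prems[THEN Ck_on_SucD])
      (use Suc.prems in simp_all)
  ultimately show ?case
    by (rule Ck_on_SucI[OF assms(1)])
qed

lemma Ck_on_inverse:
  fixes f :: "'a::real_normed_vector \<Rightarrow> 'b::real_normed_div_algebra"
  assumes "open S" "Ck_on n S f" and nz: "\<And>x. x \<in> S \<Longrightarrow> f x \<noteq> 0"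
  shows "Ck_on n S (\<lambda>x. inverse (f x))"
  using assms(2)
proof (induction n)
  case 0
  then show ?case using nz by (auto intro: continuous_on_inverse)
next
  case (Suc n)
  have "((\<lambda>x. inverse (f x)) has_derivative
      (\<lambda>v. - 1 * (inverse (f x) * frechet_derivative f (at x) v * inverse (f x)))) (at x)" if "x \<in> S" for x
    using Deriv.has_derivative_inverse[OF nz[OF that] Ck_on_Suc_has_derivative[OF Suc.prems that]] by simp
  moreover have "Ck_on n S
      (\<lambda>x. - 1 * (inverse (f x) * frechet_derivative f (at x) v * inverse (f x)))" for v
    using Suc.prems Suc.IH[OF Ck_on_SucD[OF Suc.prems]]
    by (intro Ck_on_mult Ck_on_const assms(1)) simp_all
  ultimately show ?case
    by (rule Ck_on_SucI[OF assms(1)])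
qed

section \<open>Smooth tensor fields on the total space\<close>

lemma bounded_linear_base: "bounded_linear (base :: real^('n::finite + 'k::finite) \<Rightarrow> real^'n)"
  unfolding base_def
  by (intro linear_conv_bounded_linear[THEN iffD1] linearI) (auto simp: vec_eq_iff)

lemma total_space_eq_vimage: "total_space N = base -` N"
  by (auto simp: total_space_def)

lemma open_total_space: "open N \<Longrightarrow> open (total_space N)"
  unfolding total_space_eq_vimage
  by (intro open_vimage linear_continuous_on bounded_linear_base)

lemma base_add_fibre [simp]: "base (z + t *\<^sub>R axis (Inr l) 1) = base z"
  by (simp add: base_def axis_def)

lemma add_fibre_in_total_space [simp]: "z + t *\<^sub>R axis (Inr l) 1 \<in> total_space N \<longleftrightarrow> z \<in> total_space N"
  by (simp add: total_space_def)

lemma smooth_field_const: "smooth_field N M (\<lambda>z. a)"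
  by (simp add: smooth_field_def smooth_on_def Ck_on_const)

lemma smooth_field_add:
  "open N \<Longrightarrow> smooth_field N M f \<Longrightarrow> smooth_field N M g \<Longrightarrow> smooth_field N M (\<lambda>z. f z + g z)"
  by (simp add: smooth_field_def smooth_on_def Ck_on_add open_total_space)

lemma smooth_field_mult:
  fixes f g :: "real^('n::finite + 'k::finite) \<Rightarrow> 'b::real_normed_algebra"
  shows "open N \<Longrightarrow> smooth_field N M f \<Longrightarrow> smooth_field N M g \<Longrightarrow> smooth_field N M (\<lambda>z. f z * g z)"
  by (simp add: smooth_field_def smooth_on_def Ck_on_mult open_total_space)

lemma smooth_field_inverse:
  fixes f :: "real^('n::finite + 'k::finite) \<Rightarrow> 'b::real_normed_div_algebra"
  assumes "open N" "smooth_field N M f" "\<And>z. z \<in> total_space N \<Longrightarrow> f z \<noteq> 0"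
  shows "smooth_field N M (\<lambda>z. inverse (f z))"
  using assms by (simp add: smooth_field_def smooth_on_def Ck_on_inverse open_total_space)

lemma smooth_field_compose_linear:
  "open N \<Longrightarrow> bounded_linear L \<Longrightarrow> smooth_field N M f \<Longrightarrow> smooth_field N M (\<lambda>z. L (f z))"
  by (simp add: smooth_field_def smooth_on_def Ck_on_compose_linear open_total_space)

lemma smooth_field_cong:
  assumes "open N" "\<And>z. z \<in> total_space N \<Longrightarrow> f z = g z" "smooth_field N M f"
  shows "smooth_field N M g"
proof -
  have "Ck_on n (total_space N) f \<Longrightarrow> Ck_on n (total_space N) g" for n
    by (rule Ck_on_cong[OF open_total_space[OF assms(1)] assms(2)])
  then show ?thesis
    using assms(2,3) by (auto simp: smooth_field_def smooth_on_def)
qed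

lemma smooth_field_pullback:
  "open N \<Longrightarrow> smooth_on N f \<Longrightarrow> smooth_field N M (\<lambda>z. f (base z))"
  by (simp add: smooth_field_def smooth_on_def total_space_eq_vimage Ck_on_pullback_linear
      bounded_linear_base)

lemma smooth_field_base_coordinate:
  "open N \<Longrightarrow> smooth_field N M (\<lambda>z. z $ Inl A)"
  by (simp add: smooth_field_def smooth_on_def Ck_on_bounded_linear open_total_space
      bounded_linear_vec_nth axis_def)

lemma smooth_field_sum:
  assumes "open N" "\<And>i. i \<in> I \<Longrightarrow> smooth_field N M (f i)"
  shows "smooth_field N M (\<lambda>z. \<Sum>i\<in>I. f i z)"
  using assms by (induction I rule: infinite_finite_induct)
    (auto intro: smooth_field_add smooth_field_const)

lemma smooth_field_prod:
  fixes f :: "'i \<Rightarrow> real^('n::finite + 'k::finite) \<Rightarrow> 'b::{real_normed_algebra,comm_ring_1}"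
  assumes "open N" "\<And>i. i \<in> I \<Longrightarrow> smooth_field N M (f i)"
  shows "smooth_field N M (\<lambda>z. \<Prod>i\<in>I. f i z)"
  using assms by (induction I rule: infinite_finite_induct)
    (auto intro: smooth_field_mult smooth_field_const)

lemma smooth_field_vec_nth:
  "open N \<Longrightarrow> smooth_field N M f \<Longrightarrow> smooth_field N M (\<lambda>z. f z $ i)"
  by (rule smooth_field_compose_linear[OF _ bounded_linear_vec_nth])

lemma bounded_linear_axis: "bounded_linear (axis i :: 'b::real_normed_vector \<Rightarrow> 'b^'i)"
proof
  have "norm (axis i x :: 'b^'i) \<le> norm x" for x
    unfolding norm_vec_def axis_def by (rule order_trans[OF L2_set_le_sum]) (simp_all add: if_distrib cong: if_cong)
  then show "\<exists>K. \<forall>x. norm (axis i x :: 'b^'i) \<le> norm x * K"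
    by (intro exI[of _ 1]) simp
qed (auto simp: axis_def vec_eq_iff)

lemma smooth_field_vec:
  assumes "open N" "\<And>i. smooth_field N M (\<lambda>z. f z $ i)"
  shows "smooth_field N M f"
proof -
  have "f = (\<lambda>z. \<Sum>i\<in>UNIV. axis i (f z $ i))"
    by (simp add: fun_eq_iff vec_eq_iff axis_def)
  moreover have "smooth_field N M (\<lambda>z. \<Sum>i\<in>UNIV. axis i (f z $ i))"
    by (intro smooth_field_sum smooth_field_compose_linear[OF _ bounded_linear_axis] assms)
  ultimately show ?thesis by metis
qed

lemma smooth_field_matrix_mult:
  fixes F :: "real^('n::finite + 'k::finite) \<Rightarrow> real^'j^'i" and G :: "real^('n + 'k) \<Rightarrow> real^'l^'j"
  assumes "open N" "smooth_field N M F" "smooth_field N M G"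
  shows "smooth_field N M (\<lambda>z. F z ** G z)"
  by (intro smooth_field_vec assms(1))
    (simp add: matrix_matrix_mult_def smooth_field_sum smooth_field_mult smooth_field_vec_nth assms)

lemma smooth_field_det:
  fixes F :: "real^('n::finite + 'k::finite) \<Rightarrow> real^'i^'i"
  assumes "open N" "smooth_field N M F"
  shows "smooth_field N M (\<lambda>z. det (F z))"
proof -
  have "smooth_field N M (\<lambda>z. (of_int (sign p) :: real) * (\<Prod>i\<in>UNIV. F z $ i $ p i))" for p
    by (intro smooth_field_mult smooth_field_const smooth_field_prod smooth_field_vec_nth assms)
  then show ?thesis
    unfolding det_def by (intro smooth_field_sum assms(1))
qed

lemma matrix_inv_mult:
  fixes G :: "real^'i^'i"
  assumes "invertible G"
  shows "G ** matrix_inv G = mat 1" "matrix_inv G ** G = mat 1"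
proof -
  have "G ** matrix_inv G = mat 1 \<and> matrix_inv G ** G = mat 1"
    using assms unfolding invertible_def matrix_inv_def by (rule someI_ex)
  then show "G ** matrix_inv G = mat 1" "matrix_inv G ** G = mat 1"
    by auto
qed

text \<open>
  Cramer's rule makes the inverse a rational function of the entries, which reduces its smoothness
  to that of sums, products and reciprocals.
\<close>

lemma matrix_inv_eq_cramer:
  fixes G :: "real^'i^'i"
  assumes "det G \<noteq> 0"
  shows "matrix_inv G $ i $ j =
    det (\<chi> p q. if q = i then axis j 1 $ p else G $ p $ q) * inverse (det G)"
proof -
  have "G ** matrix_inv G = mat 1"
    using assms by (simp add: matrix_inv_mult invertible_det_nz)
  then have "G *v column j (matrix_inv G) = axis j 1"
    by (metis matrix_vector_mul_assoc matrix_vector_mul_lid matrix_vector_mult_basis)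
  then show ?thesis
    unfolding cramer[OF assms] by (simp add: column_def vec_eq_iff divide_inverse)
qed

lemma smooth_field_matrix_inv:
  fixes F :: "real^('n::finite + 'k::finite) \<Rightarrow> real^'i^'i"
  assumes N: "open N" and F: "smooth_field N M F" and nz: "\<And>z. z \<in> total_space N \<Longrightarrow> det (F z) \<noteq> 0"
  shows "smooth_field N M (\<lambda>z. matrix_inv (F z))"
proof (intro smooth_field_vec N)
  fix i j
  have "smooth_field N M (\<lambda>z. (\<chi> p q. if q = i then axis j 1 $ p else F z $ p $ q))"
  proof (intro smooth_field_vec N)
    fix p q
    show "smooth_field N M
        (\<lambda>z. (\<chi> p q. if q = i then axis j 1 $ p else F z $ p $ q) $ p $ q)"
      by (cases "q = i") (simp_all add: smooth_field_const smooth_field_vec_nth N F)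
  qed
  then have "smooth_field N M
      (\<lambda>z. det (\<chi> p q. if q = i then axis j 1 $ p else F z $ p $ q) * inverse (det (F z)))"
    by (intro smooth_field_mult smooth_field_inverse smooth_field_det N F nz)
  then show "smooth_field N M (\<lambda>z. matrix_inv (F z) $ i $ j)"
    by (rule smooth_field_cong[OF N, rotated]) (simp add: matrix_inv_eq_cramer nz)
qed

section \<open>Block matrices\<close>

lemma sum_UNIV_Plus:
  fixes f :: "'a::finite + 'b::finite \<Rightarrow> 'c::comm_monoid_add"
  shows "(\<Sum>i\<in>UNIV. f i) = (\<Sum>a\<in>UNIV. f (Inl a)) + (\<Sum>b\<in>UNIV. f (Inr b))"
  using sum.Plus[of UNIV UNIV f] by simp

definition mixed_block :: "real^('n::finite + 'k::finite)^('n + 'k) \<Rightarrow> real^'k^'n" where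
  "mixed_block W = (\<chi> A l. W $ Inl A $ Inr l)"

definition fibre_block :: "real^('n::finite + 'k::finite)^('n + 'k) \<Rightarrow> real^'k^'k" where
  "fibre_block W = (\<chi> l j. W $ Inr l $ Inr j)"

text \<open>
  The pointwise content of the form \<open>w\<^sub>1 + w\<^sub>2\<close>: the base coordinates are in involution.
\<close>

definition adapted_bivector :: "real^('n::finite + 'k::finite)^('n + 'k) \<Rightarrow> bool" where
  "adapted_bivector W \<longleftrightarrow> transpose W = - W \<and> (\<forall>A B. W $ Inl A $ Inl B = 0)"

lemma adapted_bivector_entries:
  assumes "adapted_bivector W"
  shows "W $ Inl A $ Inl B = 0" "W $ Inl A $ Inr l = mixed_block W $ A $ l"
    "W $ Inr l $ Inl A = - mixed_block W $ A $ l" "W $ Inr l $ Inr j = fibre_block W $ l $ j"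
proof -
  have "transpose W $ Inl A $ Inr l = - W $ Inl A $ Inr l"
    using assms by (simp add: adapted_bivector_def)
  then show "W $ Inr l $ Inl A = - mixed_block W $ A $ l"
    by (simp add: transpose_def mixed_block_def)
qed (use assms in \<open>simp_all add: adapted_bivector_def mixed_block_def fibre_block_def\<close>)

lemma d_base_nth [simp]: "d_base A $ Inl B = (if A = B then 1 else 0)" "d_base A $ Inr l = 0"
  by (auto simp: d_base_def axis_def)

lemma d_fibre_nth [simp]: "d_fibre l $ Inr j = (if l = j then 1 else 0)" "d_fibre l $ Inl A = 0"
  by (auto simp: d_fibre_def axis_def)

lemma mixed_part_entries:
  "mixed_part c z $ Inl A $ Inl B = 0"
  "mixed_part c z $ Inl A $ Inr l = c (base z) $ A $ l"
  "mixed_part c z $ Inr l $ Inl A = - c (base z) $ A $ l"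
  "mixed_part c z $ Inr l $ Inr j = 0"
proof -
  show mixed: "mixed_part c z $ Inl A $ Inr l = c (base z) $ A $ l"
    by (simp add: mixed_part_def wedge_def if_distrib[of "\<lambda>x. _ * x"] cong: if_cong)
  have "mixed_part c z $ Inr l $ Inl A = - mixed_part c z $ Inl A $ Inr l"
    by (simp add: mixed_part_def wedge_def sum_negf[symmetric])
  then show "mixed_part c z $ Inr l $ Inl A = - c (base z) $ A $ l"
    by (simp add: mixed)
qed (simp_all add: mixed_part_def wedge_def)

lemma fibre_part_entries:
  "fibre_part e z $ Inl A $ i = 0"
  by (cases i) (simp_all add: fibre_part_def wedge_def)

lemma mixed_part_eq_iff:
  "mixed_part c z = mixed_part c' z \<longleftrightarrow> c (base z) = c' (base z)"
proof
  assume "mixed_part c z = mixed_part c' z"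
  then have "mixed_part c z $ Inl A $ Inr l = mixed_part c' z $ Inl A $ Inr l" for A l
    by simp
  then show "c (base z) = c' (base z)"
    by (simp add: mixed_part_entries vec_eq_iff)
qed (simp add: mixed_part_def)

lemma mixed_block_mixed_plus_fibre:
  assumes "W = mixed_part c z + fibre_part e z"
  shows "mixed_block W = c (base z)"
  by (simp add: assms mixed_block_def vec_eq_iff mixed_part_entries fibre_part_entries)

lemma adapted_bivector_mixed_plus_fibre:
  assumes "W = mixed_part c z + fibre_part e z" "transpose W = - W"
  shows "adapted_bivector W"
  using assms(2) unfolding adapted_bivector_def
  by (simp add: assms(1) mixed_part_entries fibre_part_entries)

text \<open>
  The matrix \<open>W\<close> is the product of \<open>P = ((c, 0), (0, 1))\<close>, which has \<open>2k\<close> columns, and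
  \<open>Q = ((0, 1), (- c\<^sup>T, E))\<close>. Thus rank \<open>2k\<close> of \<open>W\<close> forces full column rank of \<open>P\<close>, hence of \<open>c\<close>.
\<close>

lemma mixed_block_injective:
  fixes W :: "real^('n::finite + 'k::finite)^('n + 'k)"
  assumes W: "adapted_bivector W" and rk: "rank W = 2 * CARD('k)" and x: "mixed_block W *v x = 0"
  shows "x = 0"
proof -
  define P :: "real^('k + 'k)^('n + 'k)" where
    "P = (\<chi> i q. case i of Inl A \<Rightarrow> (case q of Inl l \<Rightarrow> mixed_block W $ A $ l | Inr l \<Rightarrow> 0)
      | Inr j \<Rightarrow> (case q of Inl l \<Rightarrow> 0 | Inr l \<Rightarrow> if j = l then 1 else 0))"
  define Q :: "real^('n + 'k)^('k + 'k)" where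
    "Q = (\<chi> q i. case q of Inl l \<Rightarrow> (if i = Inr l then 1 else 0) | Inr l \<Rightarrow> W $ Inr l $ i)"
  have "(P ** Q) $ i $ j = W $ i $ j" for i j
    by (cases i; cases j)
      (simp_all add: P_def Q_def matrix_matrix_mult_def sum_UNIV_Plus adapted_bivector_entries[OF W]
        if_distrib if_distribR cong: if_cong)
  then have "P ** Q = W"
    by (simp add: vec_eq_iff)
  then have "rank W \<le> rank P"
    using rank_mul_le_left by metis
  then have "rank P = CARD('k + 'k)"
    using rank_bound[of P] rk by simp
  then have "inj ((*v) P)"
    by (rule full_rank_injective[THEN iffD1])
  moreover have "P *v (\<chi> q. case q of Inl l \<Rightarrow> x $ l | Inr l \<Rightarrow> 0) = 0"
  proof -
    have "(P *v (\<chi> q. case q of Inl l \<Rightarrow> x $ l | Inr l \<Rightarrow> 0)) $ i =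
        (case i of Inl A \<Rightarrow> (mixed_block W *v x) $ A | Inr j \<Rightarrow> 0)" for i
      by (cases i) (simp_all add: P_def matrix_vector_mult_def sum_UNIV_Plus)
    then show ?thesis
      by (simp add: x vec_eq_iff split: sum.split)
  qed
  ultimately have "(\<chi> q :: 'k + 'k. case q of Inl l \<Rightarrow> x $ l | Inr l \<Rightarrow> 0) = 0"
    by (metis injD matrix_vector_mult_0_right)
  then have "(\<chi> q :: 'k + 'k. case q of Inl l \<Rightarrow> x $ l | Inr l \<Rightarrow> 0) $ Inl l = 0" for l
    by simp
  then show ?thesis
    by (simp add: vec_eq_iff)
qed

text \<open>
  The kernel of \<open>c\<^sup>T c\<close> is that of \<open>c\<close>, because \<open>x \<bullet> c\<^sup>T c x\<close> is the squared norm of \<open>c x\<close>.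
\<close>

lemma det_gram_nonzero:
  fixes c :: "real^'k^'n"
  assumes "\<And>x. c *v x = 0 \<Longrightarrow> x = 0"
  shows "det (transpose c ** c) \<noteq> 0"
proof -
  have "x = 0" if "(transpose c ** c) *v x = 0" for x
  proof -
    have "(c *v x) \<bullet> (c *v x) = x \<bullet> ((transpose c ** c) *v x)"
      by (simp add: matrix_vector_mul_assoc[symmetric]) (metis dot_lmul_matrix inner_commute)
    then show ?thesis
      using that assms by simp
  qed
  then show ?thesis
    by (metis invertible_det_nz invertible_left_inverse matrix_left_invertible_ker)
qed

section \<open>Recursion operators\<close>

text \<open>
  Blocks of this kind annihilate the vectors tangent to the fibres and have such vectors as values;
  multiplication by the identity plus such a block changes the fibre block of an adapted bivector and keeps its mixed block.
\<close>

definition base_to_fibre :: "real^'n^'k \<Rightarrow> real^('n::finite + 'k::finite)^('n + 'k)" where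
  "base_to_fibre F = (\<chi> i j. case (i, j) of (Inr l, Inl A) \<Rightarrow> F $ l $ A | _ \<Rightarrow> 0)"

text \<open>
  The base-to-fibre block \<open>F\<close> must satisfy \<open>F c = E' - E\<close>. It is built from the left inverse
  \<open>(c\<^sup>T c)\<^sup>-\<^sup>1 c\<^sup>T\<close> of \<open>c\<close>, which depends smoothly on \<open>c\<close>.
\<close>

definition recursion_matrix ::
  "real^('n::finite + 'k::finite)^('n + 'k) \<Rightarrow> real^('n + 'k)^('n + 'k) \<Rightarrow> real^('n + 'k)^('n + 'k)" where
  "recursion_matrix W W' = mat 1 + base_to_fibre ((fibre_block W' + (- 1) *\<^sub>R fibre_block W) **
     (matrix_inv (transpose (mixed_block W) ** mixed_block W) ** transpose (mixed_block W)))"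

lemma recursion_matrix_mult:
  assumes W: "adapted_bivector W" and W': "adapted_bivector W'" and eq: "mixed_block W = mixed_block W'"
    and nz: "det (transpose (mixed_block W) ** mixed_block W) \<noteq> 0"
  shows "recursion_matrix W W' ** W = W'"
proof -
  define c where "c = mixed_block W"
  define L where "L = matrix_inv (transpose c ** c) ** transpose c"
  define D where "D = fibre_block W' + (- 1) *\<^sub>R fibre_block W"
  have "matrix_inv (transpose c ** c) ** (transpose c ** c) = mat 1"
    using nz unfolding c_def
    by (simp add: matrix_inv_mult invertible_det_nz)
  then have "D ** L ** c = D"
    by (simp add: L_def matrix_mul_assoc[symmetric])
  then have DLc: "(\<Sum>A\<in>UNIV. (D ** L) $ l $ A * c $ A $ j) = fibre_block W' $ l $ j - fibre_block W $ l $ j" for l j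
    by (simp add: vec_eq_iff matrix_matrix_mult_def[of _ c] D_def)
  have R: "recursion_matrix W W' = mat 1 + base_to_fibre (D ** L)"
    by (simp only: recursion_matrix_def D_def L_def c_def)
  have mult: "recursion_matrix W W' ** W = W + base_to_fibre (D ** L) ** W"
    by (simp add: R vec_eq_iff matrix_matrix_mult_def mat_def distrib_right sum.distrib
        if_distrib[of "\<lambda>x. x * _"] cong: if_cong)
  have "(recursion_matrix W W' ** W) $ i $ j = W' $ i $ j" for i j
    unfolding mult base_to_fibre_def
    by (cases i; cases j)
      (simp_all add: matrix_matrix_mult_def[of _ W] sum_UNIV_Plus adapted_bivector_entries[OF W]
        adapted_bivector_entries[OF W'] eq[symmetric] DLc flip: c_def)
  then show ?thesis
    by (simp add: vec_eq_iff)
qed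

text \<open>
  For skew-symmetric matrices the second equation for a recursion operator is the transpose of the
  first, so it is enough to know \<open>R w = w'\<close>.
\<close>

lemma recursion_operatorI:
  fixes w w' :: "real^('n::finite + 'k::finite) \<Rightarrow> real^('n + 'k)^('n + 'k)"
  assumes "smooth_field N M R"
    and "\<And>z. z \<in> total_space N \<Longrightarrow> transpose (w z) = - w z"
    and "\<And>z. z \<in> total_space N \<Longrightarrow> transpose (w' z) = - w' z"
    and "\<And>z. z \<in> total_space N \<Longrightarrow> R z ** w z = w' z"
  shows "recursion_operator N M w w' R"
  unfolding recursion_operator_def
proof (intro conjI ballI allI assms(1))
  fix z :: "real^('n + 'k)" and \<alpha> assume z: "z \<in> total_space N"
  have sharp_skew: "sharp W \<alpha> = - (W *v \<alpha>)" if "transpose W = - W" for W :: "real^('n + 'k)^('n + 'k)" and \<alpha>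
  proof -
    have "sharp W \<alpha> = transpose W *v \<alpha>" by (simp add: sharp_def)
    then show ?thesis by (simp only: that matrix_vector_mult_def) (simp add: vec_eq_iff sum_negf)
  qed
  show "sharp (w' z) \<alpha> = R z *v sharp (w z) \<alpha>"
    using assms(2-4)[OF z]
    by (simp add: sharp_skew matrix_vector_mul_assoc linear_neg[OF matrix_vector_mul_linear])
  show "sharp (w' z) \<alpha> = sharp (w z) (transpose (R z) *v \<alpha>)"
    unfolding assms(4)[OF z, symmetric] sharp_def by (simp add: vector_matrix_mul_assoc)
qed

lemma smooth_field_mixed_block:
  assumes "open N" "smooth_field N M w"
  shows "smooth_field N M (\<lambda>z. mixed_block (w z))"
  by (rule smooth_field_vec[OF assms(1)], rule smooth_field_vec[OF assms(1)])
    (simp add: mixed_block_def smooth_field_vec_nth assms)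

lemma smooth_field_fibre_block:
  assumes "open N" "smooth_field N M w"
  shows "smooth_field N M (\<lambda>z. fibre_block (w z))"
  by (rule smooth_field_vec[OF assms(1)], rule smooth_field_vec[OF assms(1)])
    (simp add: fibre_block_def smooth_field_vec_nth assms)

lemma smooth_field_transpose:
  assumes "open N" "smooth_field N M F"
  shows "smooth_field N M (\<lambda>z. transpose (F z))"
  by (rule smooth_field_vec[OF assms(1)], rule smooth_field_vec[OF assms(1)])
    (simp add: transpose_def smooth_field_vec_nth assms)

lemma smooth_field_recursion_matrix:
  fixes w w' :: "real^('n::finite + 'k::finite) \<Rightarrow> real^('n + 'k)^('n + 'k)"
  assumes N: "open N" and w: "smooth_field N M w" and w': "smooth_field N M w'"
    and nz: "\<And>z. z \<in> total_space N \<Longrightarrow> det (transpose (mixed_block (w z)) ** mixed_block (w z)) \<noteq> 0"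
  shows "smooth_field N M (\<lambda>z. recursion_matrix (w z) (w' z))"
proof -
  define F where "F z = (fibre_block (w' z) + (- 1) *\<^sub>R fibre_block (w z)) **
    (matrix_inv (transpose (mixed_block (w z)) ** mixed_block (w z)) ** transpose (mixed_block (w z)))" for z
  have F: "smooth_field N M F"
    unfolding F_def
    by (intro smooth_field_matrix_mult smooth_field_matrix_inv smooth_field_transpose smooth_field_add
      smooth_field_compose_linear[OF N bounded_linear_scaleR_right]
      smooth_field_mixed_block smooth_field_fibre_block N w w' nz)
  have "smooth_field N M (\<lambda>z. base_to_fibre (F z))"
  proof (rule smooth_field_vec[OF N], rule smooth_field_vec[OF N])
    fix i j
    show "smooth_field N M (\<lambda>z. base_to_fibre (F z) $ i $ j)"
      by (cases i; cases j)
        (simp_all add: base_to_fibre_def smooth_field_const smooth_field_vec_nth N F)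
  qed
  then show ?thesis
    unfolding recursion_matrix_def F_def[symmetric] by (intro smooth_field_add smooth_field_const N)
qed

section \<open>Integrals of motion and the dynamical algebra\<close>

lemma toroidal_frame_base: "toroidal_frame M B C l z $ Inl A = 0"
  by (simp add: toroidal_frame_def)

lemma generated_by_toroidal_frame_base:
  assumes "V \<in> generated_by N S (toroidal_frame M B C)" "z \<in> total_space N"
  shows "V z $ Inl A = 0"
  using assms by (auto simp: generated_by_def toroidal_frame_base)

lemma inner_eq_fibre_sum:
  fixes u v :: "real^('n::finite + 'k::finite)"
  assumes "\<And>l. v $ Inr l = 0" "\<And>A. u $ Inl A = 0"
  shows "u \<bullet> v = 0"
  by (simp add: inner_vec_def sum_UNIV_Plus assms)

text \<open>
  The toroidal frame has no base components, so only the fibre derivatives of \<open>f\<close> enter.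
\<close>

lemma integrals_of_motionI:
  assumes "smooth_field N M f" "\<And>z l. z \<in> total_space N \<Longrightarrow> differential f z $ Inr l = 0"
  shows "f \<in> integrals_of_motion N M (toroidal_frame M B C)"
  using assms by (auto simp: integrals_of_motion_def inner_eq_fibre_sum toroidal_frame_base)

lemma differential_fibre_eq_0:
  assumes "open N" "smooth_field N M f" "\<And>z. z \<in> total_space N \<Longrightarrow> f z = g (base z)"
    and z: "z \<in> total_space N"
  shows "differential f z $ Inr l = 0"
proof -
  let ?f' = "frechet_derivative f (at z)"
  have "Ck_on (Suc 0) (total_space N) f"
    using assms(2) by (simp add: smooth_field_def smooth_on_def del: Ck_on.simps)
  \<comment> \<open>Along the fibre line through \<open>z\<close> in direction \<open>l\<close> the function is constant.\<close>
  from Ck_on_Suc_has_derivative[OF this z]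
  have "(f has_derivative ?f') (at (z + 0 *\<^sub>R axis (Inr l) 1))"
    by simp
  then have "((\<lambda>t. f (z + t *\<^sub>R axis (Inr l) 1)) has_derivative (\<lambda>t. ?f' (t *\<^sub>R axis (Inr l) 1))) (at 0)"
    by (rule has_derivative_compose[rotated]) (auto intro!: derivative_eq_intros)
  moreover have "(\<lambda>t. f (z + t *\<^sub>R axis (Inr l) 1)) = (\<lambda>t. f z)"
    using assms(3) z by (simp add: fun_eq_iff)
  ultimately have "(\<lambda>t. ?f' (t *\<^sub>R axis (Inr l) 1)) = (\<lambda>t. 0)"
    by (metis has_derivative_const has_derivative_unique)
  then have "?f' (1 *\<^sub>R axis (Inr l) 1) = 0"
    by (rule fun_cong)
  then show ?thesis
    by (simp add: differential_def)
qed

lemma differential_coordinate: "differential (\<lambda>z. z $ i) z = axis i 1"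
proof -
  have "frechet_derivative (\<lambda>z. z $ i) (at z) = (\<lambda>v. v $ i)"
    by (metis bounded_linear_imp_has_derivative bounded_linear_vec_nth frechet_derivative_at)
  then show ?thesis
    by (simp add: differential_def vec_eq_iff axis_def)
qed

lemma ham_nth: "ham w f z $ j = (\<Sum>i\<in>UNIV. differential f z $ i * w z $ i $ j)"
  by (simp add: ham_def sharp_def vector_matrix_mult_def)

lemma ham_coordinate: "ham w (\<lambda>z. z $ i) z = w z $ i"
  by (simp add: ham_nth differential_coordinate axis_def vec_eq_iff if_distribR if_distrib cong: if_cong)

text \<open>
  Inverting the definition of the frame: \<open>\<partial>\<^sub>j = C\<^sub>j\<^sup>i \<vartheta>\<^sub>i + B\<^sub>j\<^sup>a \<partial>\<^sub>a\<close> for an angle index \<open>j\<close>, while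
  \<open>\<partial>\<^sub>a = \<vartheta>\<^sub>a\<close> for the remaining indices.
\<close>

lemma fibre_field_eq_frame_combination:
  fixes B C :: "real^'n \<Rightarrow> real^'k^'k" and z :: "real^('n::finite + 'k::finite)"
  assumes dom: "toroidal_domain N M B C" and z: "z \<in> total_space N"
  shows "(\<Sum>l\<in>UNIV. u l *\<^sub>R d_fibre l) =
    (\<Sum>i\<in>UNIV. (if i \<in> M then \<Sum>l\<in>M. C (base z) $ i $ l * u l
                 else u i + (\<Sum>l\<in>M. B (base z) $ i $ l * u l)) *\<^sub>R toroidal_frame M B C i z)"
proof -
  let ?X = "\<lambda>i. toroidal_frame M B C i z" and ?C = "C (base z)" and ?B = "B (base z)"
  have inv: "invertible ?C" and pad: "\<And>l j. l \<notin> M \<or> j \<notin> M \<Longrightarrow> ?C $ l $ j = (if l = j then 1 else 0)"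
    using dom z by (auto simp: toroidal_domain_def total_space_def)
  \<comment> \<open>The columns of the padded matrix with index in \<open>M\<close> vanish outside \<open>M\<close>, so sums over \<open>M\<close> are
    full matrix products.\<close>
  have sum_M: "(\<Sum>i\<in>M. F $ j $ i * ?C $ i $ l) = (F ** ?C) $ j $ l" if "l \<in> M" for F :: "real^'k^'k" and j l
    unfolding matrix_matrix_mult_def using that
    by (auto simp: pad intro!: sum.mono_neutral_left)
  have d: "d_fibre l = (\<Sum>i\<in>M. ?C $ i $ l *\<^sub>R ?X i) + (\<Sum>a\<in>-M. ?B $ a $ l *\<^sub>R d_fibre a)" if l: "l \<in> M" for l
  proof -
    have "(\<Sum>i\<in>M. ?C $ i $ l *\<^sub>R ?X i) =
        (\<Sum>i\<in>M. (\<Sum>j\<in>M. (matrix_inv ?C $ j $ i * ?C $ i $ l) *\<^sub>R d_fibre j)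
             - (\<Sum>a\<in>-M. ((?B ** matrix_inv ?C) $ a $ i * ?C $ i $ l) *\<^sub>R d_fibre a))"
      by (rule sum.cong) (simp_all add: toroidal_frame_def scaleR_diff_right scaleR_sum_right mult.commute)
    also have "\<dots> = (\<Sum>j\<in>M. (\<Sum>i\<in>M. matrix_inv ?C $ j $ i * ?C $ i $ l) *\<^sub>R d_fibre j)
             - (\<Sum>a\<in>-M. (\<Sum>i\<in>M. (?B ** matrix_inv ?C) $ a $ i * ?C $ i $ l) *\<^sub>R d_fibre a)"
      unfolding sum_subtractf scaleR_sum_left
      by (subst (1 2) sum.swap) simp
    also have "\<dots> = d_fibre l - (\<Sum>a\<in>-M. ?B $ a $ l *\<^sub>R d_fibre a)"
      using l by (simp add: sum_M matrix_mul_assoc[symmetric] matrix_inv_mult[OF inv])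
        (simp add: mat_def if_distribR if_distrib[of "\<lambda>x. x *\<^sub>R _"] cong: if_cong)
    finally show ?thesis by simp
  qed
  have split: "(\<Sum>i\<in>UNIV. h i) = (\<Sum>i\<in>M. h i) + (\<Sum>i\<in>-M. h i)" for h :: "'k \<Rightarrow> real^('n + 'k)"
    using sum.union_disjoint[of M "-M" h] by (simp add: Compl_partition)
  have "(\<Sum>l\<in>M. u l *\<^sub>R d_fibre l) =
      (\<Sum>l\<in>M. (\<Sum>i\<in>M. (?C $ i $ l * u l) *\<^sub>R ?X i) + (\<Sum>a\<in>-M. (?B $ a $ l * u l) *\<^sub>R d_fibre a))"
    by (rule sum.cong[OF refl], subst d) (simp_all add: scaleR_add_right scaleR_sum_right mult.commute)
  also have "\<dots> = (\<Sum>i\<in>M. (\<Sum>l\<in>M. ?C $ i $ l * u l) *\<^sub>R ?X i)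
      + (\<Sum>a\<in>-M. (\<Sum>l\<in>M. ?B $ a $ l * u l) *\<^sub>R d_fibre a)"
    unfolding sum.distrib scaleR_sum_left by (subst (1 2) sum.swap) simp
  finally show ?thesis
    unfolding split by (simp add: toroidal_frame_def[of M B C _ z] scaleR_add_left sum.distrib)
qed

text \<open>
  The coefficients with respect to the toroidal frame are polynomial in \<open>B\<close>, \<open>C\<close> and \<open>u\<close>, hence
  smooth and dependent on the base point only, that is, integrals of motion.
\<close>

lemma fibre_field_in_dynamical_algebra:
  assumes dom: "toroidal_domain N M B C"
    and u: "\<And>l. smooth_field N M (u l)" and ub: "\<And>l z. z \<in> total_space N \<Longrightarrow> u l z = h l (base z)"
    and V: "\<And>z. z \<in> total_space N \<Longrightarrow> V z = (\<Sum>l\<in>UNIV. u l z *\<^sub>R d_fibre l)"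
  shows "V \<in> generated_by N (integrals_of_motion N M (toroidal_frame M B C)) (toroidal_frame M B C)"
proof -
  have N: "open N" and B: "smooth_on N B" and C: "smooth_on N C"
    using dom by (auto simp: toroidal_domain_def)
  define s where "s i z = (if i \<in> M then \<Sum>l\<in>M. C (base z) $ i $ l * u l z
                 else u i z + (\<Sum>l\<in>M. B (base z) $ i $ l * u l z))" for i z
  define g where "g i r = (if i \<in> M then \<Sum>l\<in>M. C r $ i $ l * h l r
                 else h i r + (\<Sum>l\<in>M. B r $ i $ l * h l r))" for i r
  have "smooth_field N M (s i)" for i
    unfolding s_def
    by (cases "i \<in> M") (simp_all add: smooth_field_add smooth_field_sum smooth_field_mult
        smooth_field_vec_nth smooth_field_pullback N B C u)
  moreover have "s i z = g i (base z)" if "z \<in> total_space N" for i z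
    by (simp add: s_def g_def ub that)
  ultimately have "s i \<in> integrals_of_motion N M (toroidal_frame M B C)" for i
    by (blast intro: integrals_of_motionI differential_fibre_eq_0[OF N])
  moreover have "V z = (\<Sum>i\<in>UNIV. s i z *\<^sub>R toroidal_frame M B C i z)" if "z \<in> total_space N" for z
    unfolding V[OF that] s_def by (rule fibre_field_eq_frame_combination[OF dom that])
  ultimately show ?thesis
    unfolding generated_by_def by blast
qed

section \<open>Hamilton representations\<close>

text \<open>
  This is why a Hamiltonian vector field tangent to the fibres has a generating function with
  \<open>c \<partial>f/\<partial>y = 0\<close>.
\<close>

lemma ham_base:
  assumes "adapted_bivector (w z)"
  shows "ham w f z $ Inl A = - (mixed_block (w z) *v (\<chi> l. differential f z $ Inr l)) $ A"
  by (simp add: ham_nth sum_UNIV_Plus adapted_bivector_entries[OF assms] matrix_vector_mult_def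
      sum_negf mult.commute)

text \<open>
  The fibre block of a bivector pairs only with the fibre derivatives of \<open>f\<close>, which vanish here.
\<close>

lemma ham_cong_mixed_block:
  assumes "adapted_bivector (w z)" "adapted_bivector (w' z)" "mixed_block (w z) = mixed_block (w' z)"
    and "\<And>l. differential f z $ Inr l = 0"
  shows "ham w f z = ham w' f z"
proof -
  have "ham w f z $ i = ham w' f z $ i" for i
    by (cases i) (simp_all add: ham_nth sum_UNIV_Plus adapted_bivector_entries[OF assms(1)]
        adapted_bivector_entries[OF assms(2)] assms(3,4))
  then show ?thesis
    by (simp add: vec_eq_iff)
qed

text \<open>
  Tangency of \<open>V\<close> to the fibres and injectivity of the mixed block leave \<open>f\<close> without fibre
  derivatives, and then the fibre blocks are invisible.
\<close>

lemma same_hamilton_representationsI: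
  fixes w w' :: "real^('n::finite + 'k::finite) \<Rightarrow> real^('n + 'k)^('n + 'k)"
  assumes w: "\<And>z. z \<in> total_space N \<Longrightarrow> adapted_bivector (w z)"
    and w': "\<And>z. z \<in> total_space N \<Longrightarrow> adapted_bivector (w' z)"
    and rk: "regular_of_rank (2 * CARD('k)) N w"
    and eq: "\<And>z. z \<in> total_space N \<Longrightarrow> mixed_block (w z) = mixed_block (w' z)"
    and S: "S = integrals_of_motion N M (toroidal_frame M B C)"
    and A: "A = generated_by N S (toroidal_frame M B C)"
  shows "same_hamilton_representations N M S A w w'"
  unfolding same_hamilton_representations_def
proof (intro ballI allI impI)
  fix V f
  assume V: "V \<in> A" and f: "smooth_field N M f \<and> (\<forall>z\<in>total_space N. V z = ham w f z)"
  have df: "differential f z $ Inr l = 0" if z: "z \<in> total_space N" for z l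
  proof -
    have "mixed_block (w z) *v (\<chi> l. differential f z $ Inr l) = 0"
      using ham_base[of w z f, OF w[OF z]] generated_by_toroidal_frame_base[OF V[unfolded A] z] f z
      by (simp add: vec_eq_iff)
    then have "(\<chi> l. differential f z $ Inr l) = 0"
      using mixed_block_injective[OF w[OF z]] rk z by (simp add: regular_of_rank_def)
    then show ?thesis
      by (simp add: vec_eq_iff)
  qed
  show "f \<in> S \<and> (\<forall>z\<in>total_space N. V z = ham w' f z)"
    unfolding S using f df by (auto intro!: integrals_of_motionI ham_cong_mixed_block w w' eq)
qed

text \<open>
  The Hamiltonian vector field of the base coordinate \<open>r\<^sup>a\<close> is row \<open>a\<close> of the bivector. For \<open>w\<close> it lies
  in the dynamical algebra, so the hypothesis applies to it and identifies the rows of \<open>w\<close> and \<open>w'\<close>.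
\<close>

lemma mixed_blocks_eq_if_same_hamilton_representations:
  fixes w w' :: "real^('n::finite + 'k::finite) \<Rightarrow> real^('n + 'k)^('n + 'k)"
  assumes dom: "toroidal_domain N M B C"
    and S: "S = integrals_of_motion N M (toroidal_frame M B C)"
    and A: "A = generated_by N S (toroidal_frame M B C)"
    and smooth: "smooth_field N M w"
    and w: "\<And>z. z \<in> total_space N \<Longrightarrow> adapted_bivector (w z)"
    and c: "\<And>z. z \<in> total_space N \<Longrightarrow> mixed_block (w z) = c (base z)"
    and same: "same_hamilton_representations N M S A w w'"
    and z: "z \<in> total_space N"
  shows "mixed_block (w z) = mixed_block (w' z)"
proof -
  have N: "open N" using dom by (simp add: toroidal_domain_def)
  have row: "w z $ Inl a = w' z $ Inl a" for a
  proof -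
    define V where "V = ham w (\<lambda>z. z $ Inl a)"
    have "V \<in> generated_by N (integrals_of_motion N M (toroidal_frame M B C)) (toroidal_frame M B C)"
    proof (rule fibre_field_in_dynamical_algebra[OF dom])
      show "smooth_field N M (\<lambda>z. mixed_block (w z) $ a $ l)" for l
        by (intro smooth_field_vec_nth smooth_field_mixed_block N smooth)
      show "mixed_block (w z) $ a $ l = c (base z) $ a $ l" if "z \<in> total_space N" for l z
        by (simp add: c that)
      show "V z = (\<Sum>l\<in>UNIV. mixed_block (w z) $ a $ l *\<^sub>R d_fibre l)" if "z \<in> total_space N" for z
      proof -
        have "V z $ i = (\<Sum>l\<in>UNIV. mixed_block (w z) $ a $ l *\<^sub>R d_fibre l) $ i" for i
          by (cases i) (simp_all add: V_def ham_coordinate adapted_bivector_entries[OF w[OF that]]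
              if_distrib cong: if_cong)
        then show ?thesis by (simp add: vec_eq_iff)
      qed
    qed
    then have "V z = ham w' (\<lambda>z. z $ Inl a) z"
      using same z smooth_field_base_coordinate[OF N, of M a]
      unfolding same_hamilton_representations_def S A V_def by blast
    then show ?thesis
      by (simp add: V_def ham_coordinate)
  qed
  show ?thesis
    by (simp add: mixed_block_def row)
qed

section \<open>Bi-Hamiltonian systems\<close>

theorem theorem4:
  fixes N :: "(real^'n) set" and M :: "'k::finite set"
    and B C :: "real^'n \<Rightarrow> real^'k^'k"
    and c c' :: "real^'n \<Rightarrow> real^'k^'n"
    and e e' :: "real^('n + 'k) \<Rightarrow> real^'k^'k"
    and w w\<^sub>1 w\<^sub>2 w' w\<^sub>1' w\<^sub>2' :: "real^('n + 'k) \<Rightarrow> real^('n + 'k)^('n + 'k)"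
    and S :: "(real^('n + 'k) \<Rightarrow> real) set"
    and A :: "(real^('n + 'k) \<Rightarrow> real^('n + 'k)) set"
  assumes "toroidal_domain N M B C"
    and "S = integrals_of_motion N M (toroidal_frame M B C)"
    and "A = generated_by N S (toroidal_frame M B C)"
    and "w\<^sub>1 = mixed_part c" and "w\<^sub>2 = fibre_part e"
    and "w\<^sub>1' = mixed_part c'" and "w\<^sub>2' = fibre_part e'"
    and "\<forall>z\<in>total_space N. w z = w\<^sub>1 z + w\<^sub>2 z"
    and "\<forall>z\<in>total_space N. w' z = w\<^sub>1' z + w\<^sub>2' z"
    and "poisson_bivector N M w" and "poisson_bivector N M w'"
    and "regular_of_rank (2 * CARD('k)) N w" and "regular_of_rank (2 * CARD('k)) N w'"
    and "\<exists>z\<in>total_space N. w z \<noteq> w' z"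
    and "PIS N M S A w" and "PIS N M S A w'"
  shows "(bi_hamiltonian_PIS N M S A w w' \<longleftrightarrow> (\<forall>z\<in>total_space N. w\<^sub>1 z = w\<^sub>1' z))
       \<and> ((\<forall>z\<in>total_space N. w\<^sub>1 z = w\<^sub>1' z) \<longrightarrow> (\<exists>R. recursion_operator N M w w' R))"
proof -
  have N: "open N"
    using assms(1) by (simp add: toroidal_domain_def)
  have smooth: "smooth_field N M w" "smooth_field N M w'"
    using assms(10,11) unfolding poisson_bivector_def by blast+
  have skew: "transpose (w z) = - w z" "transpose (w' z) = - w' z" if "z \<in> total_space N" for z
    using assms(10,11) that unfolding poisson_bivector_def by blast+
  have split: "w z = mixed_part c z + fibre_part e z" "w' z = mixed_part c' z + fibre_part e' z"
    if "z \<in> total_space N" for z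
    using assms(8,9) that unfolding assms(4-7) by blast+
  have w: "adapted_bivector (w z)" "mixed_block (w z) = c (base z)" if "z \<in> total_space N" for z
    using adapted_bivector_mixed_plus_fibre[OF split(1) skew(1)] mixed_block_mixed_plus_fibre[OF split(1)] that by blast+
  have w': "adapted_bivector (w' z)" "mixed_block (w' z) = c' (base z)" if "z \<in> total_space N" for z
    using adapted_bivector_mixed_plus_fibre[OF split(2) skew(2)] mixed_block_mixed_plus_fibre[OF split(2)] that by blast+
  have mixed_eq_iff: "(\<forall>z\<in>total_space N. w\<^sub>1 z = w\<^sub>1' z) \<longleftrightarrow>
      (\<forall>z\<in>total_space N. mixed_block (w z) = mixed_block (w' z))"
    using w(2) w'(2) by (simp add: assms(4,6) mixed_part_eq_iff)
  have nz: "det (transpose (mixed_block (w z)) ** mixed_block (w z)) \<noteq> 0" if "z \<in> total_space N" for z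
  proof (rule det_gram_nonzero)
    have "rank (w z) = 2 * CARD('k)"
      using assms(12) that unfolding regular_of_rank_def by blast
    then show "x = 0" if "mixed_block (w z) *v x = 0" for x
      using w(1)[OF \<open>z \<in> total_space N\<close>] that by (intro mixed_block_injective[of "w z"])
  qed
  show ?thesis
    unfolding mixed_eq_iff
  proof (intro conjI iffI impI)
    assume "bi_hamiltonian_PIS N M S A w w'"
    then have same: "same_hamilton_representations N M S A w w'"
      by (simp add: bi_hamiltonian_PIS_def)
    show "\<forall>z\<in>total_space N. mixed_block (w z) = mixed_block (w' z)"
      using mixed_blocks_eq_if_same_hamilton_representations[OF assms(1,2,3) smooth(1) w same] by blast
  next
    assume eq: "\<forall>z\<in>total_space N. mixed_block (w z) = mixed_block (w' z)"
    show "bi_hamiltonian_PIS N M S A w w'"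
      unfolding bi_hamiltonian_PIS_def
      using same_hamilton_representationsI[OF w(1) w'(1) assms(12) _ assms(2,3)]
        same_hamilton_representationsI[OF w'(1) w(1) assms(13) _ assms(2,3)] eq assms(15,16)
      by simp
    show "\<exists>R. recursion_operator N M w w' R"
    proof (intro exI recursion_operatorI)
      show "smooth_field N M (\<lambda>z. recursion_matrix (w z) (w' z))"
        by (rule smooth_field_recursion_matrix[OF N smooth nz])
      show "recursion_matrix (w z) (w' z) ** w z = w' z" if "z \<in> total_space N" for z
        using eq that by (intro recursion_matrix_mult w(1) w'(1) nz) auto
    qed (simp_all add: skew)
  qed
qed

end
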